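(* For every integer $t \geq 2$ there exists an integer $s$ such that every $\{P_6, K_{2,t}\}$-free graph has tree-independence number at most $s$.
   Context: All graphs are finite and simple. $P_6$ is the path on $6$ vertices and $K_{2,t}$ is the complete bipartite graph with parts of sizes $2$ and $t$. For a family $\mathcal{F}$ of graphs, a graph $G$ is $\mathcal{F}$-free if no induced subgraph of $G$ is isomorphic to a member of $\mathcal{F}$. A tree-decomposition of $G$ consists of a tree $T$ and, for each vertex $v$ of $G$, a nonempty subtree $T_v$ of $T$, such that for every edge $uv$ of $G$ the subtrees $T_u$ and $T_v$ share a node; the bag of a node $x$ is $X_x = \{v : x \in V(T_v)\}$. Writing $\alpha(X)$ for the maximum size of an independent set in $G[X]$, the $\alpha$-width of a tree-decomposition is the maximum of $\alpha(X_x)$ over all nodes $x$, and the tree-independence number of $G$ is the minimum $\alpha$-width over all tree-decompositions of $G$. *)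

theory Defs
  imports "Graph_Theory.Graph_Theory"
begin

text \<open>
  Finite simple graphs are modelled by \<open>pair_graph\<close>: finite, loop-free and symmetric, with
  every edge \<open>uv\<close> represented by the two arcs \<open>(u, v)\<close> and \<open>(v, u)\<close>.
  The type of vertices is arbitrary. Every finite graph is isomorphic to one with vertices of type
  \<^typ>\<open>nat\<close>, so a bound for all graphs over an arbitrary vertex type is already
  uniform over all finite graphs (take the instance \<^typ>\<open>nat\<close>).
\<close>

section \<open>Paths, complete bipartite graphs and families of forbidden induced subgraphs\<close>

text \<open>The parameter of \<open>path_graph\<close> is the number of vertices (not of edges).\<close>

definition path_graph :: "nat \<Rightarrow> nat pair_pre_digraph" where
  "path_graph n =
     \<lparr> pverts = {..<n}, parcs = {(i, j). i < n \<and> j < n \<and> (j = Suc i \<or> i = Suc j)} \<rparr>"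

definition complete_bipartite_graph :: "nat \<Rightarrow> nat \<Rightarrow> nat pair_pre_digraph" where
  "complete_bipartite_graph m n =
     \<lparr> pverts = {..<m + n},
       parcs = {..<m} \<times> {m..<m + n} \<union> {m..<m + n} \<times> {..<m} \<rparr>"

definition induced_free :: "'b pair_pre_digraph set \<Rightarrow> 'a pair_pre_digraph \<Rightarrow> bool" where
  "induced_free \<F> G \<longleftrightarrow>
     \<not> (\<exists>H K. induced_subgraph H (with_proj G) \<and> K \<in> \<F> \<and> digraph_iso H (with_proj K))"

lemma pair_graph_path_graph: "pair_graph (path_graph n)"
proof -
  have "finite ({..<n} \<times> {..<n})" by simp
  then have "finite (parcs (path_graph n))"
    by (rule rev_finite_subset) (auto simp: path_graph_def)
  then show ?thesis
    by unfold_locales (auto simp: path_graph_def symmetric_def intro!: symI)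
qed

lemma complete_bipartite_graph_is_complete_bipartite:
  "complete_bipartite_digraph m n (with_proj (complete_bipartite_graph m n))"
  unfolding complete_bipartite_digraph_pair_def
proof (intro conjI exI)
  show "pverts (complete_bipartite_graph m n) = {..<m} \<union> {m..<m + n}"
    by (auto simp: complete_bipartite_graph_def)
  show "{..<m} \<inter> {m..<m + n} = {}" by auto
qed (simp_all add: complete_bipartite_graph_def)

section \<open>Trees\<close>

text \<open>
  The library predicate \<open>tree\<close> cannot be used: its notion of a cycle is a directed one, so that
  \<open>u, v, u\<close> is a cycle of every symmetric digraph with an edge \<open>uv\<close>. The cycles of a simple
  graph are the closed walks without repeated vertices of length at least 3.
  The library predicate \<open>connected\<close> excludes the graph without vertices, hence so does
  \<open>is_tree\<close>.
\<close>

definition is_tree :: "'a pair_pre_digraph \<Rightarrow> bool" where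
  "is_tree T \<longleftrightarrow> pair_graph T \<and> connected (with_proj T) \<and>
     \<not> (\<exists>p. pre_digraph.cycle (with_proj T) p \<and> length p \<ge> 3)"

definition is_subtree :: "'a pair_pre_digraph \<Rightarrow> 'a pair_pre_digraph \<Rightarrow> bool" where
  "is_subtree S T \<longleftrightarrow> subgraph (with_proj S) (with_proj T) \<and> is_tree S"

section \<open>Independence numbers\<close>

definition independent_set :: "('a, 'b) pre_digraph \<Rightarrow> 'a set \<Rightarrow> bool" where
  "independent_set G S \<longleftrightarrow> S \<subseteq> verts G \<and> (\<forall>u\<in>S. \<forall>v\<in>S. (u, v) \<notin> arcs_ends G)"

definition independence_number :: "('a, 'b) pre_digraph \<Rightarrow> nat" where
  "independence_number G = Max (card ` {S. independent_set G S})"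

section \<open>Tree-decompositions and the tree-independence number\<close>

text \<open>A tree-decomposition of \<open>G\<close> is a tree \<open>T\<close> with subtrees \<open>\<tau> v\<close> for the vertices \<open>v\<close>.\<close>

definition tree_decomposition ::
  "'a pair_pre_digraph \<Rightarrow> 'n pair_pre_digraph \<Rightarrow> ('a \<Rightarrow> 'n pair_pre_digraph) \<Rightarrow> bool" where
  "tree_decomposition G T \<tau> \<longleftrightarrow>
     is_tree T \<and>
     (\<forall>v\<in>pverts G. is_subtree (\<tau> v) T) \<and>
     (\<forall>u v. (u, v) \<in> parcs G \<longrightarrow> pverts (\<tau> u) \<inter> pverts (\<tau> v) \<noteq> {})"

definition bag :: "'a pair_pre_digraph \<Rightarrow> ('a \<Rightarrow> 'n pair_pre_digraph) \<Rightarrow> 'n \<Rightarrow> 'a set" where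
  "bag G \<tau> x = {v \<in> pverts G. x \<in> pverts (\<tau> v)}"

definition alpha_width ::
  "'a pair_pre_digraph \<Rightarrow> 'n pair_pre_digraph \<Rightarrow> ('a \<Rightarrow> 'n pair_pre_digraph) \<Rightarrow> nat" where
  "alpha_width G T \<tau> =
     Max ((\<lambda>x. independence_number (with_proj G \<restriction> bag G \<tau> x)) ` pverts T)"

text \<open>
  As trees are finite, it is no restriction to take natural numbers as the nodes of the
  decomposition trees.
\<close>

definition tree_independence_number :: "'a pair_pre_digraph \<Rightarrow> nat" where
  "tree_independence_number G =
     (LEAST k. \<exists>(T :: nat pair_pre_digraph) \<tau>. tree_decomposition G T \<tau> \<and> alpha_width G T \<tau> = k)"

lemma is_tree_singleton: "is_tree \<lparr> pverts = {x}, parcs = {} \<rparr>"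
proof -
  let ?T = "\<lparr> pverts = {x}, parcs = {} \<rparr>"
  have "pair_graph ?T"
    by unfold_locales (auto simp: symmetric_def intro!: symI)
  moreover have "connected (with_proj ?T)"
    by (auto simp: connected_def strongly_connected_def mk_symmetric_def reachable_def
        intro: rtrancl_on_refl)
  moreover have "\<not> (\<exists>p. pre_digraph.cycle (with_proj ?T) p \<and> length p \<ge> 3)"
    by (auto simp: pre_digraph.cycle_def pre_digraph.awalk_def)
  ultimately show ?thesis by (simp add: is_tree_def)
qed

lemma tree_decomposition_exists:
  assumes "pair_graph G"
  shows "\<exists>(T :: nat pair_pre_digraph) \<tau>. tree_decomposition G T \<tau>"
proof -
  let ?T = "\<lparr> pverts = {0 :: nat}, parcs = {} \<rparr>"
  have "is_tree ?T" by (rule is_tree_singleton)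
  moreover have "is_subtree ?T ?T"
    using is_tree_singleton
    by (auto simp: is_subtree_def subgraph_def compatible_def wf_digraph_def)
  ultimately have "tree_decomposition G ?T (\<lambda>_. ?T)"
    by (simp add: tree_decomposition_def)
  then show ?thesis by blast
qed

lemma tree_independence_number_le_iff:
  assumes "pair_graph G"
  shows "tree_independence_number G \<le> k \<longleftrightarrow>
    (\<exists>(T :: nat pair_pre_digraph) \<tau>. tree_decomposition G T \<tau> \<and> alpha_width G T \<tau> \<le> k)"
proof -
  let ?P = "\<lambda>k. \<exists>(T :: nat pair_pre_digraph) \<tau>. tree_decomposition G T \<tau> \<and> alpha_width G T \<tau> = k"
  have "\<exists>k. ?P k" using tree_decomposition_exists[OF assms] by blast
  then have "?P (tree_independence_number G)"
    unfolding tree_independence_number_def by (rule LeastI_ex)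
  moreover have "tree_independence_number G \<le> j" if "?P j" for j
    unfolding tree_independence_number_def using that by (rule Least_le)
  ultimately show ?thesis by (metis le_trans order_refl)
qed

end

theory Submission
  imports Defs
begin

text \<open>
  Call a vertex set small if its independence number is bounded in terms of \<open>t\<close>. Any two
  nonadjacent vertices \<open>u, v\<close> are separated by a small set. This is clear if \<open>N(u)\<close> or \<open>N(v)\<close> is
  small. Otherwise the vertices of \<open>N(u)\<close> that dominate \<open>N(u)\<close> up to a small set form a clique,
  because two nonadjacent ones would have too many common neighbours, and likewise for \<open>N(v)\<close>.
  These two cliques together with \<open>N(u) \<inter> N(v)\<close> separate \<open>u\<close> from \<open>v\<close>: an induced path avoiding
  them extends to a \<open>P\<^sub>6\<close> by private neighbours of \<open>u\<close> and \<open>v\<close>.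

  Suppose that some set \<open>I\<close> has no small balanced separator. Then each small set \<open>Y\<close> leaves a
  component with more than half of \<open>I\<close>, and the vertices \<open>v\<close> that lie in this component for every
  small \<open>Y\<close> avoiding \<open>v\<close> form a clique \<open>K\<close>. For a few vertices outside \<open>K\<close>, the union of \<open>K\<close> with
  the corresponding sets \<open>Y\<close> is small and leaves a large connected set that avoids \<open>K\<close> and all the
  closed neighbourhoods of these vertices. Walking towards such sets, as in the argument of Gyarfas,
  produces an induced \<open>P\<^sub>6\<close>.

  Small balanced separators yield a tree-decomposition with small bags by the usual recursion, in
  which a maximum independent set of the current boundary is separated.
\<close>

section \<open>Independence and connectivity in a binary relation\<close>

definition indep :: "'a rel \<Rightarrow> 'a set \<Rightarrow> bool" where
  "indep E I \<longleftrightarrow> (\<forall>x\<in>I. \<forall>y\<in>I. (x, y) \<notin> E)"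

text \<open>A bound instead of the number itself, so that the bounds of a union simply add up. An
  infinite independent set has \<open>card\<close> 0 and escapes the bound; the graphs of the final
  theorem are finite.\<close>

definition alpha_le :: "'a rel \<Rightarrow> 'a set \<Rightarrow> nat \<Rightarrow> bool" where
  "alpha_le E X k \<longleftrightarrow> (\<forall>I. I \<subseteq> X \<longrightarrow> indep E I \<longrightarrow> card I \<le> k)"

lemma indep_subset: "indep E I \<Longrightarrow> J \<subseteq> I \<Longrightarrow> indep E J"
  unfolding indep_def by blast

lemma alpha_le_mono: "alpha_le E X k \<Longrightarrow> Y \<subseteq> X \<Longrightarrow> k \<le> l \<Longrightarrow> alpha_le E Y l"
  unfolding alpha_le_def by (meson le_trans subset_trans)

lemma alpha_le_empty [simp]: "alpha_le E {} k"
  unfolding alpha_le_def by auto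

lemma alpha_le_Un:
  assumes "alpha_le E X k" "alpha_le E Y l"
  shows "alpha_le E (X \<union> Y) (k + l)"
  unfolding alpha_le_def
proof (intro allI impI)
  fix I assume I: "I \<subseteq> X \<union> Y" "indep E I"
  have "card (I \<inter> X) \<le> k" "card (I - X) \<le> l"
    using assms I unfolding alpha_le_def by (meson Diff_subset Int_lower1 Int_lower2
        indep_subset, metis Diff_subset Diff_subset_conv indep_subset)
  moreover have "card I \<le> card (I \<inter> X) + card (I - X)"
    using card_Un_le[of "I \<inter> X" "I - X"] by (simp add: Int_Diff_Un)
  ultimately show "card I \<le> k + l" by linarith
qed

lemma alpha_le_UN:
  assumes "finite P" "\<And>p. p \<in> P \<Longrightarrow> alpha_le E (Y p) k"
  shows "alpha_le E (\<Union>p\<in>P. Y p) (card P * k)"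
  using assms
proof (induction P rule: finite_induct)
  case (insert p P)
  then have "alpha_le E (Y p \<union> (\<Union>p\<in>P. Y p)) (k + card P * k)"
    by (intro alpha_le_Un) auto
  then show ?case using insert by simp
qed simp

lemma alpha_le_clique:
  assumes "\<And>x y. x \<in> K \<Longrightarrow> y \<in> K \<Longrightarrow> x \<noteq> y \<Longrightarrow> (x, y) \<in> E"
  shows "alpha_le E K 1"
  unfolding alpha_le_def
proof (intro allI impI)
  fix I assume "I \<subseteq> K" "indep E I"
  then have "\<forall>x\<in>I. \<forall>y\<in>I. x = y" using assms unfolding indep_def by blast
  then show "card I \<le> 1"
    by (metis card.empty card_le_Suc0_iff_eq card.infinite One_nat_def zero_le)
qed

section \<open>Walks inside a vertex set\<close>

lemma rtrancl_on_iff_Restr: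
  "(x, y) \<in> rtrancl_on U E \<longleftrightarrow> x \<in> U \<and> (x, y) \<in> (E \<inter> U \<times> U)\<^sup>*"
proof
  show "(x, y) \<in> rtrancl_on U E \<Longrightarrow> x \<in> U \<and> (x, y) \<in> (E \<inter> U \<times> U)\<^sup>*"
    by (induction rule: rtrancl_on_induct) (auto intro: rtrancl_into_rtrancl)
  assume "x \<in> U \<and> (x, y) \<in> (E \<inter> U \<times> U)\<^sup>*"
  then have "(x, y) \<in> (E \<inter> U \<times> U)\<^sup>*" "x \<in> U" by auto
  then show "(x, y) \<in> rtrancl_on U E"
    by (induction rule: rtrancl_induct) (auto intro: rtrancl_on_into_rtrancl_on)
qed

lemma rtrancl_on_subset:
  "(x, y) \<in> rtrancl_on U E \<Longrightarrow> U \<subseteq> V \<Longrightarrow> (x, y) \<in> rtrancl_on V E"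
  by (rule rtrancl_on_mono) auto

definition conn_set :: "'a rel \<Rightarrow> 'a set \<Rightarrow> bool" where
  "conn_set E C \<longleftrightarrow> (\<forall>x\<in>C. \<forall>y\<in>C. (x, y) \<in> rtrancl_on C E)"

abbreviation component :: "'a rel \<Rightarrow> 'a set \<Rightarrow> 'a \<Rightarrow> 'a set" where
  "component E U x \<equiv> rtrancl_on U E `` {x}"

text \<open>A walk of least length is an induced path, since a repeated vertex or a chord would give
  a shortcut.\<close>

lemma shortest_path:
  assumes "(x, y) \<in> rtrancl_on U E"
  obtains n f where "f 0 = x" "f n = y" "\<And>i. i \<le> n \<Longrightarrow> f i \<in> U"
    "\<And>i j. i < j \<Longrightarrow> j \<le> n \<Longrightarrow> f i \<noteq> f j \<and> ((f i, f j) \<in> E \<longleftrightarrow> j = Suc i)"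
proof -
  let ?R = "E \<inter> U \<times> U"
  have x: "x \<in> U" and "\<exists>n. (x, y) \<in> ?R ^^ n"
    using assms by (auto simp: rtrancl_on_iff_Restr rtrancl_is_UN_relpow)
  define n where "n = (LEAST n. (x, y) \<in> ?R ^^ n)"
  have n: "(x, y) \<in> ?R ^^ n"
    unfolding n_def using \<open>\<exists>n. _\<close> by (rule LeastI_ex)
  have min: "n \<le> m" if "(x, y) \<in> ?R ^^ m" for m
    unfolding n_def using that by (rule Least_le)
  from n obtain f where f: "f 0 = x" "f n = y" "\<And>i. i < n \<Longrightarrow> (f i, f (Suc i)) \<in> ?R"
    by (auto simp: relpow_fun_conv)
  have U: "f i \<in> U" if "i \<le> n" for i
    using f x that by (cases i) auto
  have pow: "(f i, f (i + d)) \<in> ?R ^^ d" if "i + d \<le> n" for i d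
    using that
  proof (induction d)
    case (Suc d)
    then have "(f i, f (i + d)) \<in> ?R ^^ d" "(f (i + d), f (Suc (i + d))) \<in> ?R"
      using f(3) by auto
    then show ?case by (simp del: relpow.simps add: relpow_Suc_I)
  qed auto
  have ne: "f i \<noteq> f j" if "i < j" "j \<le> n" for i j
  proof
    assume "f i = f j"
    then have "(x, y) \<in> ?R ^^ (i + (n - j))"
      using pow[of 0 i] pow[of j "n - j"] that f unfolding relpow_add by auto
    from min[OF this] that show False by linarith
  qed
  have adj: "j = Suc i" if "i < j" "j \<le> n" "(f i, f j) \<in> E" for i j
  proof (rule ccontr)
    assume "j \<noteq> Suc i"
    have "(f i, f j) \<in> ?R" using that U by auto
    then have "(f 0, f j) \<in> ?R ^^ Suc i"
      using pow[of 0 i] that by (auto intro: relpow_Suc_I)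
    then have "(x, y) \<in> ?R ^^ (Suc i + (n - j))"
      using pow[of j "n - j"] that f unfolding relpow_add by auto
    from min[OF this] that \<open>j \<noteq> Suc i\<close> show False by linarith
  qed
  show thesis
  proof (rule that[of f n])
    show "f i \<noteq> f j \<and> ((f i, f j) \<in> E \<longleftrightarrow> j = Suc i)" if "i < j" "j \<le> n" for i j
      using ne adj f(3)[of i] that by auto
  qed (use f U in auto)
qed

text \<open>Only pairs \<open>i < j\<close> are tested; for a symmetric irreflexive relation they
  determine the induced subgraph.\<close>

definition P6_free :: "'a rel \<Rightarrow> 'a set \<Rightarrow> bool" where
  "P6_free E U \<longleftrightarrow> \<not> (\<exists>f :: nat \<Rightarrow> 'a. f ` {..<6} \<subseteq> U \<and>
     (\<forall>i j. i < j \<and> j < 6 \<longrightarrow> f i \<noteq> f j \<and> ((f i, f j) \<in> E \<longleftrightarrow> j = Suc i)))"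

text \<open>In a finite graph this excludes an induced biclique with parts of size 2 and
  \<open>m + 1\<close>, phrased as a bound that can be added to other bounds.\<close>

definition biclique_free :: "'a rel \<Rightarrow> 'a set \<Rightarrow> nat \<Rightarrow> bool" where
  "biclique_free E U m \<longleftrightarrow> (\<forall>u\<in>U. \<forall>v\<in>U. u \<noteq> v \<longrightarrow> (u, v) \<notin> E \<longrightarrow>
     alpha_le E (U \<inter> E `` {u} \<inter> E `` {v}) m)"

lemma P6_free_subset: "P6_free E U \<Longrightarrow> V \<subseteq> U \<Longrightarrow> P6_free E V"
  unfolding P6_free_def by (meson subset_trans)

lemma biclique_free_subset: "biclique_free E U m \<Longrightarrow> V \<subseteq> U \<Longrightarrow> biclique_free E V m"
  unfolding biclique_free_def
  by (meson Int_mono alpha_le_mono order_refl subsetD)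

section \<open>Components and connected sets of a graph\<close>

locale sym_irrefl_rel =
  fixes E :: "'a rel"
  assumes sym: "(x, y) \<in> E \<Longrightarrow> (y, x) \<in> E"
    and irrefl: "(x, x) \<notin> E"
begin

lemma conn_sym: "(x, y) \<in> rtrancl_on U E \<Longrightarrow> (y, x) \<in> rtrancl_on U E"
  using rtrancl_on_sym[of E U] sym by (auto simp: sym_def)

lemma conn_edge: "(x, y) \<in> E \<Longrightarrow> x \<in> U \<Longrightarrow> y \<in> U \<Longrightarrow> (x, y) \<in> rtrancl_on U E"
  by (meson rtrancl_on_into_rtrancl_on rtrancl_on_refl)

lemma component_subset: "component E U x \<subseteq> U"
  by (auto dest: in_rtrancl_on_in_F)

lemma conn_in_component:
  assumes "(x, y) \<in> rtrancl_on U E"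
  shows "(x, y) \<in> rtrancl_on (component E U x) E"
  using assms
proof (induction rule: rtrancl_on_induct)
  case (step y z)
  then show ?case by (meson Image_singleton_iff rtrancl_on_into_rtrancl_on)
qed auto

lemma conn_set_component: "conn_set E (component E U x)"
  unfolding conn_set_def
  by (meson Image_singleton_iff conn_in_component conn_sym rtrancl_on_trans)

lemma conn_set_subset_component:
  assumes "conn_set E C" "C \<subseteq> U" "x \<in> C"
  shows "C \<subseteq> component E U x"
  using assms unfolding conn_set_def by (auto intro: rtrancl_on_subset)

lemma conn_set_Un:
  assumes "conn_set E C" "conn_set E D" "x \<in> C" "x \<in> D"
  shows "conn_set E (C \<union> D)"
proof -
  have "(x, y) \<in> rtrancl_on (C \<union> D) E" if "y \<in> C \<union> D" for y
    using assms that unfolding conn_set_def by (metis Un_iff Un_upper1 Un_upper2 rtrancl_on_subset)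
  then show ?thesis unfolding conn_set_def by (meson conn_sym rtrancl_on_trans)
qed

lemma conn_set_insert:
  assumes "conn_set E C" "x \<in> C" "(v, x) \<in> E"
  shows "conn_set E (insert v C)"
proof -
  have "(x, y) \<in> rtrancl_on (insert v C) E" if "y \<in> insert v C" for y
    using assms that sym unfolding conn_set_def
    by (auto intro: rtrancl_on_subset conn_edge)
  then show ?thesis unfolding conn_set_def by (meson conn_sym rtrancl_on_trans)
qed

lemma crossing_edge:
  assumes "(x, y) \<in> rtrancl_on U E" "x \<notin> Q" "y \<in> Q"
  obtains g h where "g \<in> U" "h \<in> U" "g \<notin> Q" "h \<in> Q" "(g, h) \<in> E"
proof -
  have "y \<notin> Q \<or> (\<exists>g h. g \<in> U \<and> h \<in> U \<and> g \<notin> Q \<and> h \<in> Q \<and> (g, h) \<in> E)"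
    using assms(1) by (induction rule: rtrancl_on_induct) (use assms(2) in auto)
  then show thesis using assms(3) that by blast
qed

section \<open>Separating nonadjacent vertices\<close>

text \<open>Reduces a use of \<open>P6_free\<close> to a list of edges and non-edges. The remaining
  inequalities hold by irreflexivity or because equal vertices would have equal neighbours.\<close>

lemma no_P6:
  assumes "P6_free E U" "{a, b, c, d, e, f} \<subseteq> U"
    "(a, b) \<in> E" "(b, c) \<in> E" "(c, d) \<in> E" "(d, e) \<in> E" "(e, f) \<in> E"
    "(a, c) \<notin> E" "(a, d) \<notin> E" "(a, e) \<notin> E" "(a, f) \<notin> E"
    "(b, d) \<notin> E" "(b, e) \<notin> E" "(b, f) \<notin> E"
    "(c, e) \<notin> E" "(c, f) \<notin> E" "(d, f) \<notin> E" "a \<noteq> c"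
  shows False
proof -
  have ne: "distinct [a, b, c, d, e, f]"
    using assms(3-) sym irrefl by auto
  let ?f = "(!) [a, b, c, d, e, f]"
  have "?f i \<noteq> ?f j \<and> ((?f i, ?f j) \<in> E \<longleftrightarrow> j = Suc i)" if "i < j" "j < 6" for i j
  proof -
    have "j \<in> {1, 2, 3, 4, 5}" "i \<in> {0, 1, 2, 3, 4}" using that by auto
    then show ?thesis using assms(3-) ne that(1) by (auto simp: eval_nat_numeral)
  qed
  moreover have "?f ` {..<6} \<subseteq> U"
    using assms(2) by (auto simp: eval_nat_numeral lessThan_Suc)
  ultimately show False using assms(1) unfolding P6_free_def by blast
qed

text \<open>The bound \<open>5 * m\<close> is what two nonadjacent such vertices would enforce:
  \<open>A\<close> is covered by the at most \<open>2 * m\<close> missed by each of them and their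
  at most \<open>m\<close> common neighbours, all sizes in terms of independent sets.\<close>

lemma dominating_vertices_clique:
  assumes "biclique_free E U m" "A \<subseteq> U" "\<not> alpha_le E A (5 * m)"
  shows "alpha_le E {a \<in> A. alpha_le E (A - insert a (E `` {a})) (2 * m)} 1"
proof (rule alpha_le_clique, rule ccontr)
  fix a a'
  assume a: "a \<in> {a \<in> A. alpha_le E (A - insert a (E `` {a})) (2 * m)}"
    and a': "a' \<in> {a \<in> A. alpha_le E (A - insert a (E `` {a})) (2 * m)}"
    and ne: "a \<noteq> a'" "(a, a') \<notin> E"
  have "alpha_le E (U \<inter> E `` {a} \<inter> E `` {a'}) m"
    using assms a a' ne unfolding biclique_free_def by blast
  with a a' have "alpha_le E ((A - insert a (E `` {a})) \<union> (A - insert a' (E `` {a'})) \<union>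
      (U \<inter> E `` {a} \<inter> E `` {a'})) (2 * m + 2 * m + m)"
    by (intro alpha_le_Un) auto
  then have "alpha_le E A (2 * m + 2 * m + m)"
    by (rule alpha_le_mono) (use assms(2) ne sym in auto)
  with assms(3) show False by (simp add: algebra_simps)
qed

text \<open>The bound \<open>6 * m\<close> comes from deleting a whole neighbourhood,
  \<open>5 * m\<close> for its private part and \<open>m\<close> for the common part. The other
  separator, common neighbours and two cliques, has bound \<open>m + 2\<close>, which is no larger
  as \<open>m \<ge> 1\<close>.\<close>

lemma separate_nonadjacent:
  assumes m: "m \<ge> 1" and P6: "P6_free E U" and bf: "biclique_free E U m"
    and uv: "u \<in> U" "v \<in> U" "u \<noteq> v" "(u, v) \<notin> E"
  obtains X where "X \<subseteq> U - {u, v}" "alpha_le E X (6 * m)" "(u, v) \<notin> rtrancl_on (U - X) E"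
proof -
  have vu: "(v, u) \<notin> E" using uv sym by blast
  define M where "M = U \<inter> E `` {u} \<inter> E `` {v}"
  define A where "A = U \<inter> E `` {u} - E `` {v}"
  define B where "B = U \<inter> E `` {v} - E `` {u}"
  have M: "alpha_le E M m" using bf uv unfolding biclique_free_def M_def by blast
  have few: "alpha_le E (U \<inter> E `` {x} \<inter> E `` {y}) m"
    if "x \<in> U" "y \<in> U" "x \<noteq> y" "(x, y) \<notin> E" for x y
    using bf that unfolding biclique_free_def by blast
  show thesis
  proof (cases "alpha_le E A (5 * m) \<or> alpha_le E B (5 * m)")
    case True
    have "\<exists>w\<in>{u, v}. alpha_le E (U \<inter> E `` {w}) (6 * m)"
    proof -
      have "alpha_le E (A \<union> M) (5 * m + m) \<or> alpha_le E (B \<union> M) (5 * m + m)"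
        using True M alpha_le_Un by blast
      moreover have "A \<union> M = U \<inter> E `` {u}" "B \<union> M = U \<inter> E `` {v}"
        unfolding A_def B_def M_def by auto
      ultimately show ?thesis by auto
    qed
    then obtain w where w: "w \<in> {u, v}" "alpha_le E (U \<inter> E `` {w}) (6 * m)" ..
    define w' where "w' = (if w = u then v else u)"
    \<comment> \<open>Deleting its neighbourhood isolates \<open>w\<close>: a walk leaving
      \<open>w\<close> would have to enter a deleted vertex.\<close>
    have "(w, w') \<notin> rtrancl_on (U - U \<inter> E `` {w}) E"
    proof
      assume "(w, w') \<in> rtrancl_on (U - U \<inter> E `` {w}) E"
      then obtain g h where "h \<in> U - U \<inter> E `` {w}" "g \<notin> - {w}" "(g, h) \<in> E"
        by (rule crossing_edge[where Q = "- {w}"]) (use w uv in \<open>auto simp: w'_def\<close>)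
      then show False by auto
    qed
    then have "(u, v) \<notin> rtrancl_on (U - U \<inter> E `` {w}) E"
      using w conn_sym by (auto simp: w'_def split: if_splits)
    moreover have "U \<inter> E `` {w} \<subseteq> U - {u, v}"
      using w uv vu irrefl by auto
    ultimately show thesis using w(2) that by blast
  next
    case False
    define dom where "dom Z = {a \<in> Z. alpha_le E (Z - insert a (E `` {a})) (2 * m)}" for Z
    define X where "X = M \<union> dom A \<union> dom B"
    have AB: "A \<subseteq> U" "B \<subseteq> U" unfolding A_def B_def by auto
    have d1: "alpha_le E (dom A) 1" "alpha_le E (dom B) 1"
      unfolding dom_def using False dominating_vertices_clique[OF bf AB(1)]
        dominating_vertices_clique[OF bf AB(2)] by auto
    have "alpha_le E X (m + 1 + 1)"
      unfolding X_def by (intro alpha_le_Un M d1)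
    then have X: "alpha_le E X (6 * m)" by (rule alpha_le_mono) (use m in auto)
    have "X \<subseteq> U - {u, v}"
      unfolding X_def M_def dom_def A_def B_def using uv vu irrefl by auto
    have "(u, v) \<notin> rtrancl_on (U - X) E"
    proof
      assume "(u, v) \<in> rtrancl_on (U - X) E"
      then obtain n f where f: "f 0 = u" "f n = v" "\<And>i. i \<le> n \<Longrightarrow> f i \<in> U - X"
        and ind: "\<And>i j. i < j \<Longrightarrow> j \<le> n \<Longrightarrow> f i \<noteq> f j \<and> ((f i, f j) \<in> E \<longleftrightarrow> j = Suc i)"
        by (rule shortest_path) blast
      \<comment> \<open>\<open>n\<close> counts edges. The values 0 and 1 contradict the choice of
        \<open>u\<close> and \<open>v\<close>, for 2 the middle vertex lies in \<open>M\<close>, and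
        from 5 on the path contains six consecutive vertices. Only 3 and 4 remain.\<close>
      have "n \<noteq> 0" using f uv by (metis)
      have "n \<noteq> 1" using ind[of 0 1] f uv by auto
      have "n \<noteq> 2"
      proof
        assume n: "n = 2"
        have "f 1 \<in> M" unfolding M_def
          using n f f(3)[of 1] ind[of 0 1] ind[of 1 2] sym by auto
        then show False using f(3)[of 1] n unfolding X_def by auto
      qed
      have "\<not> n \<ge> 5"
      proof
        assume n: "n \<ge> 5"
        have "f ` {..<6} \<subseteq> U" using f(3) n by auto
        moreover have "\<forall>i j. i < j \<and> j < 6 \<longrightarrow> f i \<noteq> f j \<and> ((f i, f j) \<in> E \<longleftrightarrow> j = Suc i)"
          using ind n by auto
        ultimately show False using P6 unfolding P6_free_def by blast
      qed
      then consider "n = 3" | "n = 4"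
        using \<open>n \<noteq> 0\<close> \<open>n \<noteq> 1\<close> \<open>n \<noteq> 2\<close> by linarith
      then show False
      proof cases
        case 1
        define a b where "a = f 1" and "b = f 2"
        have e: "(u, a) \<in> E" "(a, b) \<in> E" "(b, v) \<in> E" "(u, b) \<notin> E" "(a, v) \<notin> E"
          using ind[of 0 1] ind[of 1 2] ind[of 2 3] ind[of 0 2] ind[of 1 3] f 1
          unfolding a_def b_def by auto
        have ab: "a \<in> A" "b \<in> B" "a \<notin> dom A" "b \<notin> dom B" "a \<in> U" "b \<in> U"
          using e f(3)[of 1] f(3)[of 2] 1 sym unfolding a_def b_def A_def B_def X_def by auto
        \<comment> \<open>Private neighbours of \<open>u\<close> that see neither inner vertex of
          the path \<open>u, a, b, v\<close>. As \<open>a\<close> is not dominating, more than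
          \<open>2 * m\<close> are missed by \<open>a\<close>, and at most \<open>m\<close> of these
          are common neighbours of \<open>u\<close> and \<open>b\<close>. The set \<open>B'\<close>
          is symmetric.\<close>
        define A' where "A' = A - insert a (E `` {a}) - E `` {b}"
        define B' where "B' = B - insert b (E `` {b}) - E `` {a}"
        have A': "\<not> alpha_le E A' m"
        proof
          assume "alpha_le E A' m"
          then have "alpha_le E (A' \<union> U \<inter> E `` {u} \<inter> E `` {b}) (m + m)"
            by (intro alpha_le_Un few) (use uv ab e in \<open>auto simp: B_def\<close>)
          then have "alpha_le E (A - insert a (E `` {a})) (2 * m)"
            by (rule alpha_le_mono) (auto simp: A'_def A_def)
          then show False using ab unfolding dom_def by auto
        qed
        have B': "\<not> alpha_le E B' m"
        proof
          assume "alpha_le E B' m"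
          then have "alpha_le E (B' \<union> U \<inter> E `` {v} \<inter> E `` {a}) (m + m)"
            by (intro alpha_le_Un few) (use uv ab e sym in \<open>auto simp: A_def\<close>)
          then have "alpha_le E (B - insert b (E `` {b})) (2 * m)"
            by (rule alpha_le_mono) (auto simp: B'_def B_def)
          then show False using ab unfolding dom_def by auto
        qed
        \<comment> \<open>Otherwise \<open>a', u, a, b, v, b'\<close> is an induced path.\<close>
        have complete: "(a', b') \<in> E" if "a' \<in> A'" "b' \<in> B'" for a' b'
        proof (rule ccontr)
          assume "(a', b') \<notin> E"
          with that ab e uv show False
            by (intro no_P6[OF P6, of a' u a b v b'])
              (auto simp: A'_def B'_def A_def B_def dest: sym)
        qed
        \<comment> \<open>Two nonadjacent vertices of \<open>A'\<close>, available because
          \<open>m \<ge> 1\<close>, have all of \<open>B'\<close> as common neighbours, which is too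
          much.\<close>
        obtain I where I: "I \<subseteq> A'" "indep E I" "\<not> card I \<le> m"
          using A' unfolding alpha_le_def by blast
        then obtain a1 a2 where a12: "a1 \<in> I" "a2 \<in> I" "a1 \<noteq> a2"
          using m by (metis card_le_Suc0_iff_eq One_nat_def card.infinite le_trans zero_le)
        obtain J where J: "J \<subseteq> B'" "indep E J" "\<not> card J \<le> m"
          using B' unfolding alpha_le_def by blast
        have "alpha_le E (U \<inter> E `` {a1} \<inter> E `` {a2}) m"
          using I a12 by (intro few) (auto simp: A'_def A_def indep_def)
        moreover have "J \<subseteq> U \<inter> E `` {a1} \<inter> E `` {a2}"
          using complete J I a12 by (auto simp: B'_def B_def)
        ultimately show False using J unfolding alpha_le_def by blast
      next
        case 2
        define a c b where "a = f 1" and "c = f 2" and "b = f 3"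
        have e: "(u, a) \<in> E" "(a, c) \<in> E" "(c, b) \<in> E" "(b, v) \<in> E"
          "(u, c) \<notin> E" "(u, b) \<notin> E" "(a, b) \<notin> E" "(a, v) \<notin> E" "(c, v) \<notin> E"
          "u \<noteq> c" "u \<noteq> b"
          using ind[of 0 1] ind[of 1 2] ind[of 2 3] ind[of 3 4] ind[of 0 2] ind[of 0 3] ind[of 1 3]
            ind[of 1 4] ind[of 2 4] f 2
          unfolding a_def b_def c_def by auto
        have ab: "a \<in> A" "a \<notin> dom A" "a \<in> U" "b \<in> U" "c \<in> U"
          using e f(3)[of 1] f(3)[of 2] f(3)[of 3] 2 sym
          unfolding a_def b_def c_def A_def X_def by auto
        \<comment> \<open>Now \<open>b\<close> and \<open>c\<close> are both nonadjacent to
          \<open>u\<close>, so each shares at most \<open>m\<close> neighbours with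
          \<open>u\<close>. More than \<open>2 * m\<close> private neighbours of \<open>u\<close>
          are missed by \<open>a\<close>, hence one is missed by all three and extends the path at
          \<open>u\<close>.\<close>
        have "\<exists>a'. a' \<in> A - insert a (E `` {a}) - E `` {c} - E `` {b}"
        proof (rule ccontr)
          assume "\<not> ?thesis"
          then have sub: "A - insert a (E `` {a}) \<subseteq>
              (U \<inter> E `` {u} \<inter> E `` {c}) \<union> (U \<inter> E `` {u} \<inter> E `` {b})"
            by (auto simp: A_def)
          have "alpha_le E ((U \<inter> E `` {u} \<inter> E `` {c}) \<union> (U \<inter> E `` {u} \<inter> E `` {b})) (m + m)"
            by (intro alpha_le_Un few) (use uv ab e in auto)
          then have "alpha_le E (A - insert a (E `` {a})) (2 * m)"
            by (rule alpha_le_mono) (use sub in auto)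
          then show False using ab unfolding dom_def by auto
        qed
        then obtain a' where "a' \<in> A - insert a (E `` {a}) - E `` {c} - E `` {b}" ..
        then show False
          by (intro no_P6[OF P6, of a' u a c b v])
            (use e ab uv in \<open>auto simp: A_def dest: sym\<close>)
      qed
    qed
    with \<open>X \<subseteq> U - {u, v}\<close> X show thesis using that by blast
  qed
qed

section \<open>Balanced separators\<close>

text \<open>The bound \<open>30 * m + 1\<close> pays for five separators of bound
  \<open>6 * m\<close> and one clique: five path vertices must be avoided at once before the sixth
  is chosen.\<close>

lemma balanced_separator:
  assumes m: "m \<ge> 1" and P6: "P6_free E U" and bf: "biclique_free E U m" and I: "finite I"
  obtains S where "S \<subseteq> U" "alpha_le E S (30 * m + 1)"
    "\<And>x. x \<in> U - S \<Longrightarrow> 2 * card (I \<inter> component E (U - S) x) \<le> card I"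
proof (rule ccontr)
  note separatorI = that
  assume "\<not> thesis"
  \<comment> \<open>More than half of \<open>I\<close>, so that any two big sets meet.\<close>
  define big where "big C \<longleftrightarrow> card I < 2 * card (I \<inter> C)" for C
  have big: "\<exists>x\<in>U - S. big (component E (U - S) x)" if "S \<subseteq> U" "alpha_le E S (30 * m + 1)" for S
    using that \<open>\<not> thesis\<close> separatorI unfolding big_def by (meson not_le)
  have big_mono: "big D" if "big C" "C \<subseteq> D" for C D
    using that card_mono[of "I \<inter> D" "I \<inter> C"] I unfolding big_def by fastforce
  have big_meet: "\<exists>x. x \<in> C \<and> x \<in> D" if "big C" "big D" for C D
  proof (rule ccontr)
    assume "\<not> ?thesis"
    then have "card (I \<inter> C \<union> I \<inter> D) = card (I \<inter> C) + card (I \<inter> D)"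
      using I by (intro card_Un_disjoint) auto
    moreover have "card (I \<inter> C \<union> I \<inter> D) \<le> card I" using I by (intro card_mono) auto
    ultimately show False using that unfolding big_def by linarith
  qed
  \<comment> \<open>\<open>Y\<close> shows that \<open>v\<close> is not central: \<open>v\<close>
    survives the deletion of \<open>Y\<close> but lies outside the big component, which is named by
    its vertex \<open>x\<close>.\<close>
  define avoids where "avoids v Y x \<longleftrightarrow> Y \<subseteq> U \<and> v \<notin> Y \<and> alpha_le E Y (6 * m) \<and>
    big (component E (U - Y) x) \<and> v \<notin> component E (U - Y) x" for v Y x
  define K where "K = {v \<in> U. \<forall>Y x. \<not> avoids v Y x}"
  have K: "alpha_le E K 1"
  proof (rule alpha_le_clique, rule ccontr)
    fix u v assume uv: "u \<in> K" "v \<in> K" "u \<noteq> v" "(u, v) \<notin> E"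
    then have "u \<in> U" "v \<in> U" unfolding K_def by auto
    from separate_nonadjacent[OF m P6 bf this uv(3,4)]
    obtain X where X: "X \<subseteq> U - {u, v}" "alpha_le E X (6 * m)" "(u, v) \<notin> rtrancl_on (U - X) E" .
    have "alpha_le E X (30 * m + 1)" using X(2) by (rule alpha_le_mono) auto
    then obtain x where x: "big (component E (U - X) x)" using big X by blast
    \<comment> \<open>The big component cannot contain both of two separated vertices, so
      \<open>X\<close> is a witness against one of them.\<close>
    have "u \<in> component E (U - X) x \<Longrightarrow> v \<in> component E (U - X) x \<Longrightarrow> False"
      using X(3) by (meson Image_singleton_iff conn_sym rtrancl_on_trans)
    then have "avoids u X x \<or> avoids v X x"
      using X x unfolding avoids_def by blast
    then show False using uv unfolding K_def by blast
  qed
  \<comment> \<open>Delete \<open>K\<close> and a witness \<open>Y p\<close> for each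
    \<open>p\<close>. The big component that remains meets the one left by \<open>Y p\<close> and
    hence lies inside it. That one contains no neighbour of \<open>p\<close>, since such a neighbour
    would pull in \<open>p\<close>, which is not in \<open>Y p\<close>.\<close>
  have far: "\<exists>C. conn_set E C \<and> big C \<and> C \<subseteq> U - K \<and> (\<forall>p\<in>P. p \<notin> C \<and> E `` {p} \<inter> C = {})"
    if P: "P \<subseteq> U - K" "finite P" "card P \<le> 5" for P
  proof -
    have "\<forall>p\<in>P. \<exists>Y x. avoids p Y x" using P unfolding K_def by auto
    then obtain Y x where Y: "\<And>p. p \<in> P \<Longrightarrow> avoids p (Y p) (x p)" by metis
    define S where "S = K \<union> (\<Union>p\<in>P. Y p)"
    have "alpha_le E S (1 + card P * (6 * m))"
      unfolding S_def using P(2) Y K by (intro alpha_le_Un alpha_le_UN) (auto simp: avoids_def)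
    then have "alpha_le E S (30 * m + 1)"
      by (rule alpha_le_mono) (use P(3) mult_right_mono[of "card P" 5 "6 * m"] in auto)
    moreover have "S \<subseteq> U" using Y unfolding S_def K_def avoids_def by auto
    ultimately obtain y where y: "big (component E (U - S) y)" using big by blast
    define C where "C = component E (U - S) y"
    have C: "conn_set E C" "C \<subseteq> U - S"
      unfolding C_def by (rule conn_set_component, rule component_subset)
    have "p \<notin> C \<and> E `` {p} \<inter> C = {}" if p: "p \<in> P" for p
    proof -
      let ?D = "component E (U - Y p) (x p)"
      have D: "big ?D" "p \<notin> ?D" "p \<in> U - Y p" using Y[OF p] p P unfolding avoids_def by auto
      obtain z where z: "z \<in> C" "z \<in> ?D" using big_meet y D unfolding C_def by metis
      have "C \<subseteq> component E (U - Y p) z"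
        using C z p unfolding S_def by (intro conn_set_subset_component) auto
      then have CD: "C \<subseteq> ?D" using z by (auto intro: rtrancl_on_trans)
      have "q \<notin> ?D" if "(p, q) \<in> E" for q
      proof
        assume q: "q \<in> ?D"
        then have "(q, p) \<in> rtrancl_on (U - Y p) E"
          using sym[OF that] D(3) in_rtrancl_on_in_F(2)[of "x p" q] by (intro conn_edge) auto
        with q D(2) show False by (auto intro: rtrancl_on_trans)
      qed
      with CD D(2) show ?thesis by auto
    qed
    then show ?thesis using C y unfolding S_def C_def by blast
  qed
  \<comment> \<open>Invariant of the walk: an induced path outside \<open>K\<close> with
    \<open>n + 1\<close> vertices and a big set \<open>C\<close> that hangs on the last vertex and
    is neither met nor touched by the earlier ones. The last vertex may belong to \<open>C\<close>,
    as it does for \<open>n = 0\<close>.\<close>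
  define path where "path n f C \<longleftrightarrow>
    (\<forall>i\<le>n. f i \<in> U - K) \<and>
    (\<forall>i j. i < j \<and> j \<le> n \<longrightarrow> f i \<noteq> f j \<and> ((f i, f j) \<in> E \<longleftrightarrow> j = Suc i)) \<and>
    C \<subseteq> U - K \<and> big C \<and> conn_set E (insert (f n) C) \<and>
    (\<forall>i<n. f i \<notin> C \<and> E `` {f i} \<inter> C = {})" for n and f :: "nat \<Rightarrow> 'a" and C
  have "\<exists>f C. path n f C" if "n \<le> 5" for n
    using that
  proof (induction n)
    case 0
    obtain C where C: "conn_set E C" "big C" "C \<subseteq> U - K" using far[of "{}"] by auto
    then obtain v where "v \<in> C" using big_meet by blast
    then have "path 0 (\<lambda>_. v) C" unfolding path_def using C by (auto simp: insert_absorb)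
    then show ?case by blast
  next
    case (Suc n)
    then obtain f C where path: "path n f C" by auto
    have "card (f ` {..n}) \<le> 5" using card_image_le[of "{..n}" f] Suc.prems by auto
    moreover have "f ` {..n} \<subseteq> U - K" using path unfolding path_def by auto
    ultimately obtain D where D: "conn_set E D" "big D" "D \<subseteq> U - K"
      "\<And>i. i \<le> n \<Longrightarrow> f i \<notin> D \<and> E `` {f i} \<inter> D = {}"
      using far[of "f ` {..n}"] by auto
    define Z where "Z = C \<union> D"
    have bigC: "big C" and CK: "C \<subseteq> U - K" using path unfolding path_def by auto
    obtain d where d: "d \<in> C" "d \<in> D" using big_meet[OF bigC D(2)] by blast
    \<comment> \<open>\<open>D\<close> is connected and avoids the closed neighbourhood
      \<open>N\<close> of the last vertex, so the component \<open>C'\<close> contains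
      \<open>D\<close> and is big.\<close>
    define N where "N = insert (f n) (E `` {f n})"
    define C' where "C' = component E (Z - N) d"
    have "D \<subseteq> C'"
      unfolding C'_def by (intro conn_set_subset_component D d) (use D in \<open>auto simp: Z_def N_def\<close>)
    have C'Z: "C' \<subseteq> Z - N" unfolding C'_def by (rule component_subset)
    \<comment> \<open>A walk from \<open>f n\<close> to \<open>C'\<close> enters \<open>C'\<close>
      by an edge from \<open>g\<close> to \<open>h\<close>. By maximality of the component
      \<open>g\<close> lies in \<open>N\<close>, and \<open>g\<close> is not \<open>f n\<close>
      because \<open>h\<close> is not in \<open>N\<close>. So \<open>g\<close> is a neighbour of
      \<open>f n\<close> attached to \<open>C'\<close>, and it becomes the next path vertex.\<close>
    have "conn_set E (insert (f n) C \<union> D)"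
      using path d D unfolding path_def by (intro conn_set_Un) auto
    then have "(f n, d) \<in> rtrancl_on (insert (f n) Z) E"
      using d unfolding conn_set_def Z_def by auto
    then obtain g h where gh: "g \<in> insert (f n) Z" "g \<notin> C'" "h \<in> C'" "(g, h) \<in> E"
      by (rule crossing_edge[where Q = C']) (use \<open>D \<subseteq> C'\<close> C'Z d in \<open>auto simp: N_def\<close>)
    have "g \<noteq> f n" using gh C'Z by (auto simp: N_def)
    then have gZ: "g \<in> Z" using gh by auto
    have "g \<in> N"
    proof (rule ccontr)
      assume "g \<notin> N"
      then have "(h, g) \<in> rtrancl_on (Z - N) E"
        using \<open>g \<notin> N\<close> gZ gh sym C'Z by (intro conn_edge) auto
      then show False using gh unfolding C'_def by (auto intro: rtrancl_on_trans)
    qed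
    then have fg: "(f n, g) \<in> E" using \<open>g \<noteq> f n\<close> by (auto simp: N_def)
    have Z_far: "f i \<notin> Z \<and> E `` {f i} \<inter> Z = {}" if "i < n" for i
      using path D(4)[of i] that unfolding path_def Z_def by auto
    define f' where "f' = f(Suc n := g)"
    have "path (Suc n) f' C'"
      unfolding path_def
    proof (intro conjI allI impI)
      show "f' i \<in> U - K" if "i \<le> Suc n" for i
        using path that gZ D(3) CK unfolding f'_def path_def Z_def by auto
      show "f' i \<noteq> f' j" if "i < j \<and> j \<le> Suc n" for i j
        using path that gZ Z_far[of i] \<open>g \<noteq> f n\<close> unfolding f'_def path_def
        by (cases "i = n") auto
      show "(f' i, f' j) \<in> E \<longleftrightarrow> j = Suc i" if "i < j \<and> j \<le> Suc n" for i j
        using path that gZ Z_far[of i] fg unfolding f'_def path_def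
        by (cases "i = n") auto
      show "C' \<subseteq> U - K" using C'Z D(3) CK unfolding Z_def by auto
      show "big C'" using D(2) \<open>D \<subseteq> C'\<close> by (rule big_mono)
      show "conn_set E (insert (f' (Suc n)) C')"
        using gh conn_set_component unfolding f'_def C'_def by (auto intro: conn_set_insert)
      show "f' i \<notin> C'" "E `` {f' i} \<inter> C' = {}" if "i < Suc n" for i
        using that Z_far[of i] C'Z unfolding f'_def N_def by (cases "i = n"; auto)+
    qed
    then show ?case by blast
  qed
  from this[of 5] obtain f C where "path 5 f C" by auto
  then have "f ` {..<6} \<subseteq> U \<and>
      (\<forall>i j. i < j \<and> j < 6 \<longrightarrow> f i \<noteq> f j \<and> ((f i, f j) \<in> E \<longleftrightarrow> j = Suc i))"
    unfolding path_def by auto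
  then show False using P6 unfolding P6_free_def by blast
qed

end

section \<open>Decompositions along rooted trees\<close>

text \<open>
  The nodes of the tree are \<open>0, \<dots>, n - 1\<close>, the parent \<open>p i\<close> of a node \<open>i > 0\<close> is smaller than \<open>i\<close>,
  and \<open>0\<close> is the root. The last condition makes the nodes whose bags contain a given vertex a
  subtree: each of them but the smallest has its parent among them.
\<close>

definition parent_decomp ::
  "'a rel \<Rightarrow> 'a set \<Rightarrow> nat \<Rightarrow> (nat \<Rightarrow> nat) \<Rightarrow> (nat \<Rightarrow> 'a set) \<Rightarrow> bool" where
  "parent_decomp E U n p B \<longleftrightarrow> 0 < n \<and> (\<forall>i. 0 < i \<and> i < n \<longrightarrow> p i < i) \<and>
     (\<forall>i<n. B i \<subseteq> U) \<and> (\<forall>v\<in>U. \<exists>i<n. v \<in> B i) \<and>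
     (\<forall>u\<in>U. \<forall>v\<in>U. (u, v) \<in> E \<longrightarrow> (\<exists>i<n. u \<in> B i \<and> v \<in> B i)) \<and>
     (\<forall>v i j. j < i \<and> i < n \<and> v \<in> B i \<and> v \<in> B j \<longrightarrow> v \<in> B (p i))"

text \<open>The set \<open>W\<close> is kept in the root bag so that the tree can later be hung by
  its root on another one that shares vertices of \<open>W\<close>.\<close>

definition decomposable :: "'a rel \<Rightarrow> 'a set \<Rightarrow> 'a set \<Rightarrow> nat \<Rightarrow> bool" where
  "decomposable E U W k \<longleftrightarrow>
     (\<exists>n p B. parent_decomp E U n p B \<and> W \<subseteq> B 0 \<and> (\<forall>i<n. alpha_le E (B i) k))"

lemma parent_decompD:
  assumes "parent_decomp E U n p B"
  shows "0 < n"
    and "0 < i \<Longrightarrow> i < n \<Longrightarrow> p i < i"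
    and "i < n \<Longrightarrow> B i \<subseteq> U"
    and "v \<in> U \<Longrightarrow> \<exists>i<n. v \<in> B i"
    and "u \<in> U \<Longrightarrow> v \<in> U \<Longrightarrow> (u, v) \<in> E \<Longrightarrow> \<exists>i<n. u \<in> B i \<and> v \<in> B i"
    and "j < i \<Longrightarrow> i < n \<Longrightarrow> v \<in> B i \<Longrightarrow> v \<in> B j \<Longrightarrow> v \<in> B (p i)"
  using assms unfolding parent_decomp_def by blast+

lemma decomposable_single: "alpha_le E U k \<Longrightarrow> decomposable E U U k"
  unfolding decomposable_def parent_decomp_def
  by (rule exI[of _ 1], rule exI[of _ id], rule exI[of _ "\<lambda>_. U"]) auto

text \<open>The second tree is shifted by \<open>n\<close> and its root is made a child of the first
  root. A shared vertex lies in both root bags, so its nodes stay connected across the new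
  edge.\<close>

lemma decomposable_Un:
  assumes "decomposable E U W k" "decomposable E U' W' k" "U \<inter> U' \<subseteq> W \<inter> W'"
    and no_edge: "\<And>x y. x \<in> U - U' \<Longrightarrow> y \<in> U' - U \<Longrightarrow> (x, y) \<notin> E \<and> (y, x) \<notin> E"
  shows "decomposable E (U \<union> U') W k"
proof -
  obtain n p B where 1: "parent_decomp E U n p B" "W \<subseteq> B 0" "\<forall>i<n. alpha_le E (B i) k"
    using assms(1) unfolding decomposable_def by blast
  obtain n' p' B' where 2: "parent_decomp E U' n' p' B'" "W' \<subseteq> B' 0" "\<forall>i<n'. alpha_le E (B' i) k"
    using assms(2) unfolding decomposable_def by blast
  define q where "q i = (if i < n then p i else if i = n then 0 else n + p' (i - n))" for i
  define D where "D i = (if i < n then B i else B' (i - n))" for i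
  note d1 = parent_decompD[OF 1(1)] and d2 = parent_decompD[OF 2(1)]
  have D1: "D i = B i" if "i < n" for i using that unfolding D_def by simp
  have D2: "D (n + i) = B' i" for i unfolding D_def by simp
  have ex1: "\<exists>i<n + n'. P (D i)" if "\<exists>i<n. P (B i)" for P
    using that D1 by (metis trans_less_add1)
  have ex2: "\<exists>i<n + n'. P (D i)" if "\<exists>i<n'. P (B' i)" for P
    using that D2 by (metis nat_add_left_cancel_less)
  have split: "\<exists>i'. i = n + i' \<and> i' < n'" if "\<not> i < n" "i < n + n'" for i
    using that by (intro exI[of _ "i - n"]) auto
  have "parent_decomp E (U \<union> U') (n + n') q D"
    unfolding parent_decomp_def
  proof (intro conjI allI impI ballI)
    show "0 < n + n'" using d1(1) by simp
    show "q i < i" if h: "0 < i \<and> i < n + n'" for i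
    proof (cases "i < n")
      case False
      then obtain i' where i: "i = n + i'" "i' < n'" using h split by blast
      show ?thesis using d1(1) d2(2)[of i'] i unfolding q_def by (cases "i' = 0") auto
    qed (use h d1(2) q_def in auto)
    show "D i \<subseteq> U \<union> U'" if h: "i < n + n'" for i
    proof (cases "i < n")
      case False
      then obtain i' where "i = n + i'" "i' < n'" using h split by blast
      then show ?thesis using d2(3)[of i'] D2 by auto
    qed (use d1(3)[of i] D1 in auto)
    show "\<exists>i<n + n'. v \<in> D i" if "v \<in> U \<union> U'" for v
      using that ex1[of "\<lambda>X. v \<in> X"] ex2[of "\<lambda>X. v \<in> X"] d1(4)[of v] d2(4)[of v] by blast
    show "\<exists>i<n + n'. u \<in> D i \<and> v \<in> D i" if "u \<in> U \<union> U'" "v \<in> U \<union> U'" "(u, v) \<in> E" for u v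
    proof -
      have "u \<in> U \<and> v \<in> U \<or> u \<in> U' \<and> v \<in> U'"
        using that no_edge by blast
      then show ?thesis
        using that(3) ex1[of "\<lambda>X. u \<in> X \<and> v \<in> X"] ex2[of "\<lambda>X. u \<in> X \<and> v \<in> X"]
          d1(5)[of u v] d2(5)[of u v] by blast
    qed
    show "v \<in> D (q i)" if h: "j < i \<and> i < n + n' \<and> v \<in> D i \<and> v \<in> D j" for v i j
    proof (cases "i < n")
      case True
      then have "v \<in> B (p i)" using h d1(6)[of j i v] D1[of i] D1[of j] by auto
      moreover have "p i < n" using True h d1(2)[of i] by linarith
      ultimately show ?thesis using True by (simp add: q_def D1)
    next
      case False
      then obtain i' where i: "i = n + i'" "i' < n'" using h split by blast
      have vi: "v \<in> B' i'" using h i D2 by auto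
      \<comment> \<open>The smaller node \<open>j\<close> lies in the first tree, which makes
        \<open>v\<close> a shared vertex, or in the second.\<close>
      have "v \<in> W \<inter> W' \<or> (\<exists>j'. j = n + j' \<and> j' < i')"
      proof (cases "j < n")
        case True
        then have "v \<in> U" using h d1(3)[of j] D1[of j] by blast
        moreover have "v \<in> U'" using vi i d2(3)[of i'] by blast
        ultimately show ?thesis using assms(3) by blast
      qed (use h i split[of j] in auto)
      then show ?thesis
      proof
        assume v: "v \<in> W \<inter> W'"
        show ?thesis
        proof (cases "i' = 0")
          case True
          then show ?thesis using v 1(2) d1(1) i by (auto simp: q_def D1)
        next
          case False
          \<comment> \<open>The root of the second tree contains \<open>v\<close> and serves as the
            smaller node.\<close>
          then have "v \<in> B' (p' i')" using v vi 2(2) i d2(6)[of 0 i' v] by blast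
          then show ?thesis using False i by (simp add: q_def D2)
        qed
      next
        assume "\<exists>j'. j = n + j' \<and> j' < i'"
        then obtain j' where j': "j = n + j'" "j' < i'" by blast
        then have "v \<in> B' (p' i')" using h vi i d2(6)[of j' i' v] D2 by auto
        then show ?thesis using j' i by (simp add: q_def D2)
      qed
    qed
  qed
  moreover have "W \<subseteq> D 0" using 1(2) d1(1) D1 by simp
  moreover have "alpha_le E (D i) k" if h: "i < n + n'" for i
  proof (cases "i < n")
    case False
    then obtain i' where "i = n + i'" "i' < n'" using h split by blast
    then show ?thesis using 2(3) D2 by auto
  qed (use 1(3) D1 in auto)
  ultimately show ?thesis unfolding decomposable_def by blast
qed

text \<open>\<open>R\<close> is the root bag, and the decomposition of each piece is hung on it
  along the neighbours of that piece in \<open>R\<close>.\<close>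

lemma decomposable_star:
  assumes "finite \<C>" "alpha_le E R k" "sym E"
    and "\<And>C. C \<in> \<C> \<Longrightarrow> decomposable E (C \<union> R \<inter> E `` C) (R \<inter> E `` C) k"
    and "\<And>C. C \<in> \<C> \<Longrightarrow> C \<inter> R = {}"
    and "\<And>C D x y. C \<in> \<C> \<Longrightarrow> D \<in> \<C> \<Longrightarrow> C \<noteq> D \<Longrightarrow> x \<in> C \<Longrightarrow> y \<in> D \<Longrightarrow> x \<noteq> y \<and> (x, y) \<notin> E"
  shows "decomposable E (R \<union> \<Union>\<C>) R k"
  using assms
proof (induction \<C> rule: finite_induct)
  case empty
  then show ?case by (simp add: decomposable_single)
next
  case (insert C \<C>)
  have disj: "x \<notin> D" if "x \<in> C" "D \<in> \<C>" for x D
    using insert.prems(5)[of C D x x] insert.hyps(2) that by auto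
  have CR: "C \<inter> R = {}" using insert.prems(4) by simp
  have "decomposable E ((R \<union> \<Union>\<C>) \<union> (C \<union> R \<inter> E `` C)) R k"
  proof (rule decomposable_Un)
    show "decomposable E (R \<union> \<Union>\<C>) R k"
    proof (rule insert.IH)
      show "x \<noteq> y \<and> (x, y) \<notin> E" if "D \<in> \<C>" "D' \<in> \<C>" "D \<noteq> D'" "x \<in> D" "y \<in> D'" for D D' x y
        using insert.prems(5)[of D D' x y] that by blast
    qed (use insert.prems(1-4) in auto)
    show "decomposable E (C \<union> R \<inter> E `` C) (R \<inter> E `` C) k"
      using insert.prems(3)[of C] by simp
    show "(R \<union> \<Union>\<C>) \<inter> (C \<union> R \<inter> E `` C) \<subseteq> R \<inter> (R \<inter> E `` C)"
      using disj CR by auto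
    show "(x, y) \<notin> E \<and> (y, x) \<notin> E"
      if xy: "x \<in> (R \<union> \<Union>\<C>) - (C \<union> R \<inter> E `` C)" "y \<in> (C \<union> R \<inter> E `` C) - (R \<union> \<Union>\<C>)" for x y
    proof -
      have y: "y \<in> C" using xy by blast
      have "(y, x) \<notin> E"
      proof
        assume "(y, x) \<in> E"
        then obtain D where "D \<in> \<C>" "x \<in> D" using xy y by blast
        then show False using insert.prems(5)[of C D y x] insert.hyps(2) y \<open>(y, x) \<in> E\<close> by auto
      qed
      then show ?thesis using \<open>sym E\<close> by (meson symE)
    qed
  qed
  moreover have "(R \<union> \<Union>\<C>) \<union> (C \<union> R \<inter> E `` C) = R \<union> \<Union>(insert C \<C>)" by auto
  ultimately show ?case by simp
qed

text \<open>The boundary keeps the bound \<open>4 * Suc k\<close>, and the new bag adds a separator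
  and one vertex, hence \<open>5 * Suc k\<close>. Below it, a component sees the separator, the
  extra vertex and a part of \<open>W\<close> of bound \<open>2 * Suc k + k\<close>, which is again
  within \<open>4 * Suc k\<close>.\<close>

lemma (in sym_irrefl_rel) decomposable_if_separators:
  assumes "finite U"
    and sep: "\<And>V I. V \<subseteq> U \<Longrightarrow> I \<subseteq> V \<Longrightarrow> \<exists>S\<subseteq>V. alpha_le E S k \<and>
      (\<forall>x\<in>V - S. 2 * card (I \<inter> component E (V - S) x) \<le> card I)"
  shows "W \<subseteq> V \<Longrightarrow> V \<subseteq> U \<Longrightarrow> alpha_le E W (4 * Suc k) \<Longrightarrow> decomposable E V W (5 * Suc k)"
proof (induction "card (V - W)" arbitrary: V W rule: less_induct)
  case less
  have fV: "finite V" using less.prems assms(1) finite_subset by blast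
  show ?case
  proof (cases "V = W")
    case True
    have "alpha_le E W (5 * Suc k)" using less.prems(3) by (rule alpha_le_mono) auto
    then show ?thesis using True decomposable_single by blast
  next
    case False
    \<comment> \<open>Putting a vertex outside \<open>W\<close> into the bag makes the measure drop
      even if the separator lies inside \<open>W\<close>.\<close>
    then obtain x where x: "x \<in> V" "x \<notin> W" using less.prems(1) by blast
    \<comment> \<open>Balancing a maximum independent set of \<open>W\<close> controls all
      independent sets of \<open>W\<close> by exchange.\<close>
    let ?P = "\<lambda>I. I \<subseteq> W \<and> indep E I"
    have "?P {}" unfolding indep_def by simp
    moreover have "\<forall>I. ?P I \<longrightarrow> card I < Suc (4 * Suc k)"
      using less.prems(3) unfolding alpha_le_def by (auto simp: less_Suc_eq_le)
    ultimately have "\<exists>I. ?P I \<and> (\<forall>J. ?P J \<longrightarrow> card J \<le> card I)"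
      by (rule ex_has_greatest_nat)
    then obtain I where I: "?P I" and max: "\<And>J. ?P J \<Longrightarrow> card J \<le> card I" by blast
    have fI: "finite I" using I less.prems(1) fV by (meson finite_subset)
    have cI: "card I \<le> 4 * Suc k" using I less.prems(3) unfolding alpha_le_def by simp
    have "I \<subseteq> V" using I less.prems(1) by blast
    from sep[OF less.prems(2) this] obtain S where S: "S \<subseteq> V" "alpha_le E S k"
      "\<forall>x\<in>V - S. 2 * card (I \<inter> component E (V - S) x) \<le> card I" by blast
    have "alpha_le E {x} 1" by (rule alpha_le_clique) auto
    then have S': "alpha_le E (insert x S) (Suc k)" using alpha_le_Un[of E "{x}" 1 S k] S(2) by simp
    define R where "R = insert x S \<union> W"
    have R: "alpha_le E R (5 * Suc k)"
      using alpha_le_Un[OF S' less.prems(3)] unfolding R_def by (simp add: algebra_simps)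
    have RV: "R \<subseteq> V" unfolding R_def using x S(1) less.prems(1) by auto
    define \<C> where "\<C> = component E (V - R) ` (V - R)"
    have Csub: "C \<subseteq> V - R" if "C \<in> \<C>" for C
      using that component_subset unfolding \<C>_def by auto
    have "decomposable E (R \<union> \<Union>\<C>) R (5 * Suc k)"
    proof (rule decomposable_star[OF _ R])
      show "finite \<C>" using fV unfolding \<C>_def by auto
      show "Relation.sym E" using sym by (auto simp: sym_def)
      show "C \<inter> R = {}" if "C \<in> \<C>" for C using Csub[OF that] by auto
      show "a \<noteq> b \<and> (a, b) \<notin> E" if CD: "C \<in> \<C>" "D \<in> \<C>" "C \<noteq> D" "a \<in> C" "b \<in> D" for C D a b
      proof (rule ccontr)
        obtain c d where cd: "C = component E (V - R) c" "D = component E (V - R) d"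
          using CD unfolding \<C>_def by auto
        have "a \<in> V - R" "b \<in> V - R" using CD Csub by auto
        moreover assume "\<not> (a \<noteq> b \<and> (a, b) \<notin> E)"
        ultimately have "(a, b) \<in> rtrancl_on (V - R) E" using conn_edge by auto
        with CD cd have "(c, d) \<in> rtrancl_on (V - R) E"
          by (metis Image_singleton_iff conn_sym rtrancl_on_trans)
        then have "C = D" unfolding cd by (auto intro: rtrancl_on_trans dest: conn_sym)
        then show False using CD by simp
      qed
      show "decomposable E (C \<union> R \<inter> E `` C) (R \<inter> E `` C) (5 * Suc k)" if C: "C \<in> \<C>" for C
      proof (rule less.hyps)
        have "card (C \<union> R \<inter> E `` C - R \<inter> E `` C) \<le> card C"
          using fV Csub[OF C] by (intro card_mono) (auto intro: finite_subset)
        also have "\<dots> < card (V - W)"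
          using fV Csub[OF C] x by (intro psubset_card_mono) (auto simp: R_def)
        finally show "card (C \<union> R \<inter> E `` C - R \<inter> E `` C) < card (V - W)" .
        show "C \<union> R \<inter> E `` C \<subseteq> U" using Csub[OF C] RV less.prems(2) by auto
        obtain c where c: "c \<in> V - R" "C = component E (V - R) c" using C unfolding \<C>_def by auto
        define D where "D = component E (V - S) c"
        have CD: "C \<subseteq> D" unfolding c D_def by (auto simp: R_def intro: rtrancl_on_subset)
        have DV: "D \<subseteq> V - S" unfolding D_def by (rule component_subset)
        \<comment> \<open>A neighbour of \<open>C\<close> that survives the deletion of
          \<open>S\<close> lies in the same component \<open>D\<close> of
          \<open>V - S\<close>.\<close>
        have "R \<inter> E `` C \<subseteq> insert x S \<union> W \<inter> D"
        proof
          fix z assume z: "z \<in> R \<inter> E `` C"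
          then obtain y where y: "y \<in> C" "(y, z) \<in> E" by auto
          show "z \<in> insert x S \<union> W \<inter> D"
          proof (cases "z \<in> insert x S")
            case False
            then have "(y, z) \<in> rtrancl_on (V - S) E"
              using y z RV CD DV by (intro conn_edge) auto
            then have "z \<in> D" using y CD unfolding D_def by (auto intro: rtrancl_on_trans)
            then show ?thesis using False z unfolding R_def by auto
          qed blast
        qed
        \<comment> \<open>Exchange: \<open>J\<close> inside \<open>D\<close> and the part of
          \<open>I\<close> outside \<open>D \<union> S\<close> have no edges between them, so by
          maximality \<open>J\<close> is no larger than the part of \<open>I\<close> inside
          \<open>D \<union> S\<close>. That part has at most half of \<open>I\<close> in
          \<open>D\<close> and at most \<open>k\<close> vertices in \<open>S\<close>.\<close>
        moreover have "alpha_le E (W \<inter> D) (2 * Suc k + k)"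
          unfolding alpha_le_def
        proof (intro allI impI)
          fix J assume J: "J \<subseteq> W \<inter> D" "indep E J"
          have fJ: "finite J" using J less.prems(1) fV by (meson finite_subset le_infE)
          have cross: "(a, b) \<notin> E" if "a \<in> J" "b \<in> I - (D \<union> S)" for a b
          proof
            assume "(a, b) \<in> E"
            then have "(a, b) \<in> rtrancl_on (V - S) E"
              using that J DV I less.prems(1) by (intro conn_edge) auto
            then have "b \<in> D" using that J unfolding D_def by (auto intro: rtrancl_on_trans)
            then show False using that by auto
          qed
          have "(a, b) \<notin> E" if "a \<in> J \<union> (I - (D \<union> S))" "b \<in> J \<union> (I - (D \<union> S))" for a b
            using that cross[of a b] cross[of b a] sym[of a b] I J(2) unfolding indep_def by auto
          then have "?P (J \<union> (I - (D \<union> S)))"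
            using I J(1) unfolding indep_def by auto
          then have "card (J \<union> (I - (D \<union> S))) \<le> card I" by (rule max)
          moreover have "card (J \<union> (I - (D \<union> S))) = card J + card (I - (D \<union> S))"
            using J fJ fI by (intro card_Un_disjoint) auto
          moreover have "card I = card (I \<inter> (D \<union> S)) + card (I - (D \<union> S))"
            using fI by (metis card_Int_Diff)
          moreover have "card (I \<inter> (D \<union> S)) \<le> card (I \<inter> D) + card (I \<inter> S)"
            by (metis Int_Un_distrib card_Un_le)
          moreover have "card (I \<inter> S) \<le> k"
            using S(2) I unfolding alpha_le_def by (meson Int_lower1 Int_lower2 indep_subset)
          moreover have "2 * card (I \<inter> D) \<le> card I"
            unfolding D_def using c by (intro S(3)[rule_format]) (auto simp: R_def)
          ultimately show "card J \<le> 2 * Suc k + k" using cI by linarith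
        qed
        ultimately show "alpha_le E (R \<inter> E `` C) (4 * Suc k)"
          using alpha_le_Un[OF S', of "W \<inter> D" "2 * Suc k + k"] by (auto intro: alpha_le_mono)
      qed auto
    qed
    moreover have "R \<union> \<Union>\<C> = V" using Csub RV unfolding \<C>_def by auto
    moreover have "W \<subseteq> R" unfolding R_def by auto
    ultimately show ?thesis unfolding decomposable_def by (metis subset_trans)
  qed
qed

section \<open>From parent functions to tree-decompositions\<close>

text \<open>The same \<open>p\<close> serves for the whole tree and for its subtrees. The comparison
  of \<open>i\<close> and \<open>j\<close> discards the arbitrary value of \<open>p\<close> at the
  root, and a parent outside \<open>N\<close> gives no arc.\<close>

definition parent_tree :: "(nat \<Rightarrow> nat) \<Rightarrow> nat set \<Rightarrow> nat pair_pre_digraph" where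
  "parent_tree p N = \<lparr> pverts = N,
     parcs = {(i, j). i \<in> N \<and> j \<in> N \<and> (i < j \<and> i = p j \<or> j < i \<and> j = p i)} \<rparr>"

lemma pair_graph_parent_tree:
  assumes "finite N"
  shows "pair_graph (parent_tree p N)"
proof -
  have "finite (parcs (parent_tree p N))"
    by (rule finite_subset[of _ "N \<times> N"]) (use assms in \<open>auto simp: parent_tree_def\<close>)
  then show ?thesis
    using assms by unfold_locales (auto simp: parent_tree_def symmetric_def intro!: symI)
qed

text \<open>The largest node of a cycle would have its parent as both neighbours.\<close>

lemma parent_tree_acyclic:
  assumes "pre_digraph.cycle (with_proj (parent_tree p N)) c"
  shows "length c < 3"
proof (rule ccontr)
  let ?T = "with_proj (parent_tree p N)"
  assume "\<not> length c < 3"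
  then have n3: "length c \<ge> 3" by simp
  define n where "n = length c"
  interpret pair_pre_digraph "parent_tree p N" .
  obtain u where u: "set c \<subseteq> parcs (parent_tree p N)" "pcas u c u" "distinct (tl (pawalk_verts u c))"
    "c \<noteq> []"
    using assms unfolding cycle_def awalk_def by auto
  define x where "x k = pawalk_verts u c ! k" for k
  \<comment> \<open>The vertex list is written once through tails and once through heads, so that
    consecutive entries are the ends of an arc.\<close>
  have v1: "pawalk_verts u c = map fst c @ [snd (last c)]"
    using awalk_verts_conv[of u c] u(4) by simp
  have v2: "pawalk_verts u c = fst (hd c) # map snd c"
    using awalk_verts_conv'[of u c u] u by simp
  have arc: "(x k, x (Suc k)) \<in> parcs (parent_tree p N)" if "k < n" for k
  proof -
    have "x k = fst (c ! k)" using that unfolding x_def v1 n_def by (simp add: nth_append)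
    moreover have "x (Suc k) = snd (c ! k)" using that unfolding x_def v2 n_def by simp
    ultimately show ?thesis using u(1) that unfolding n_def by auto
  qed
  have closed: "x 0 = x n"
  proof -
    have "fst (hd c) = u" using u by (cases c) auto
    moreover have "snd (last c) = u" if "pcas w c u" "c \<noteq> []" for w c
      using that by (induction c arbitrary: w) auto
    ultimately show ?thesis
      unfolding x_def using u v1 v2 by (metis length_map n_def nth_Cons_0 nth_append_length)
  qed
  have inj: "i = j" if "x i = x j" "i \<in> {1..n}" "j \<in> {1..n}" for i j
  proof -
    have "map snd c ! (i - 1) = map snd c ! (j - 1)" "distinct (map snd c)"
      using that u(3) unfolding x_def v2 by auto
    then have "i - 1 = j - 1"
      using that by (subst (asm) nth_eq_iff_index_eq) (auto simp: n_def)
    then show ?thesis using that by auto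
  qed
  have "Max (x ` {1..n}) \<in> x ` {1..n}" using n3 unfolding n_def by (intro Max_in) auto
  then obtain i where i: "i \<in> {1..n}" "x i = Max (x ` {1..n})" by auto
  have max: "x j \<le> x i" if "j \<in> {1..n}" for j
    unfolding i(2) using that by (intro Max_ge) auto
  \<comment> \<open>The indices from 1 to \<open>n\<close> list every vertex of the cycle once, as
    \<open>x 0 = x n\<close>. The cyclic neighbours \<open>l\<close> and \<open>r\<close> of
    \<open>i\<close> differ because \<open>n\<close> is at least 3.\<close>
  define l where "l = (if i = 1 then n else i - 1)"
  define r where "r = (if i = n then 1 else Suc i)"
  have lr: "l \<in> {1..n}" "r \<in> {1..n}" "l \<noteq> r"
    using i(1) n3 unfolding l_def r_def n_def by (auto split: if_splits)
  have "(x l, x i) \<in> parcs (parent_tree p N)"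
    using arc[of "i - 1"] i(1) closed unfolding l_def by (auto split: if_splits)
  moreover have "(x i, x r) \<in> parcs (parent_tree p N)"
    using arc[of i] arc[of 0] i(1) closed unfolding r_def by (auto split: if_splits)
  ultimately have "x l = p (x i)" "x r = p (x i)"
    using max[OF lr(1)] max[OF lr(2)] by (auto simp: parent_tree_def)
  then show False using inj[of l r] lr by simp
qed

text \<open>Parents decrease within \<open>N\<close>, so following them ends in
  \<open>Min N\<close>, which plays the root; this is why only nodes above another node of
  \<open>N\<close> need a parent.\<close>

lemma is_tree_parent_tree:
  assumes "finite N" "N \<noteq> {}"
    and parent: "\<And>i j. i \<in> N \<Longrightarrow> j \<in> N \<Longrightarrow> j < i \<Longrightarrow> p i < i \<and> p i \<in> N"
  shows "is_tree (parent_tree p N)"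
proof -
  let ?T = "parent_tree p N"
  interpret T: pair_graph ?T by (rule pair_graph_parent_tree) fact
  have to_Min: "i \<in> N \<Longrightarrow> (i, Min N) \<in> rtrancl_on N (parcs ?T)" for i
  proof (induction i rule: less_induct)
    case (less i)
    show ?case
    proof (cases "i = Min N")
      case True
      then show ?thesis using less.prems by auto
    next
      case False
      then have "Min N < i" "Min N \<in> N" using less.prems assms by (auto simp: le_neq_trans)
      then have "p i < i" "p i \<in> N" using parent less.prems by auto
      then have "(i, p i) \<in> parcs ?T" using less.prems by (auto simp: parent_tree_def)
      then show ?thesis
        using less.IH[OF \<open>p i < i\<close> \<open>p i \<in> N\<close>] less.prems
        by (rule converse_rtrancl_on_into_rtrancl_on)
    qed
  qed
  have "Relation.sym (rtrancl_on N (parcs ?T))"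
    using T.pair_sym_arcs by (intro rtrancl_on_sym) (simp add: symmetric_def)
  then have "(i, j) \<in> rtrancl_on N (parcs ?T)" if "i \<in> N" "j \<in> N" for i j
    using to_Min[OF that(1)] to_Min[OF that(2)] by (meson rtrancl_on_trans symE)
  then have "(i, j) \<in> rtrancl_on N ((parcs ?T)\<^sup>s)" if "i \<in> N" "j \<in> N" for i j
    using that rtrancl_on_mono[of "parcs ?T" "(parcs ?T)\<^sup>s" N N i j] by (auto simp: symcl_def)
  then have "connected (with_proj ?T)"
    unfolding connected_conv using assms(2) by (simp add: parent_tree_def)
  moreover have "\<not> (\<exists>c. pre_digraph.cycle (with_proj ?T) c \<and> length c \<ge> 3)"
    using parent_tree_acyclic by (meson not_le)
  ultimately show ?thesis unfolding is_tree_def using T.pair_graph by blast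
qed

lemma independence_number_le:
  assumes "finite X" "alpha_le (parcs G) X k"
  shows "independence_number (with_proj G \<restriction> X) \<le> k"
proof -
  let ?H = "with_proj G \<restriction> X"
  have ends: "arcs_ends ?H = {(u, v) \<in> parcs G. u \<in> X \<and> v \<in> X}"
    by (auto simp: arcs_ends_conv)
  have eq: "{S. independent_set ?H S} = {S. S \<subseteq> X \<and> indep (parcs G) S}"
    unfolding independent_set_def indep_def ends by auto
  then have "finite {S. independent_set ?H S}"
    using assms(1) by (auto intro: finite_subset[of _ "Pow X"])
  moreover have "{} \<in> {S. independent_set ?H S}" by (simp add: independent_set_def)
  ultimately show ?thesis
    unfolding independence_number_def
    by (subst Max_le_iff) (use assms(2) eq in \<open>auto simp: alpha_le_def\<close>)
qed

lemma tree_independence_number_le_if_decomposable: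
  assumes G: "pair_graph G" and "decomposable (parcs G) (pverts G) W k"
  shows "tree_independence_number G \<le> k"
proof -
  interpret G: pair_graph G by (rule G)
  obtain n p B where pd: "parent_decomp (parcs G) (pverts G) n p B"
    and k: "\<And>i. i < n \<Longrightarrow> alpha_le (parcs G) (B i) k"
    using assms(2) unfolding decomposable_def by blast
  note d = parent_decompD[OF pd]
  define T where "T = parent_tree p {..<n}"
  \<comment> \<open>With these subtrees the bag of node \<open>i\<close> is again
    \<open>B i\<close>.\<close>
  define \<tau> where "\<tau> v = parent_tree p {i. i < n \<and> v \<in> B i}" for v
  have T: "is_tree T"
    unfolding T_def
  proof (rule is_tree_parent_tree)
    show "{..<n} \<noteq> {}" using d(1) by auto
    fix i j assume "i \<in> {..<n}" "j \<in> {..<n}" "j < i"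
    then show "p i < i \<and> p i \<in> {..<n}" using d(2)[of i] by simp
  qed simp
  have sub: "is_tree (\<tau> v)" if "v \<in> pverts G" for v
    unfolding \<tau>_def
  proof (rule is_tree_parent_tree)
    show "{i. i < n \<and> v \<in> B i} \<noteq> {}" using d(4)[OF that] by auto
    fix i j assume "i \<in> {i. i < n \<and> v \<in> B i}" "j \<in> {i. i < n \<and> v \<in> B i}" "j < i"
    then show "p i < i \<and> p i \<in> {i. i < n \<and> v \<in> B i}"
      using d(2)[of i] d(6)[of j i v] by auto
  qed simp
  have "is_subtree (\<tau> v) T" if "v \<in> pverts G" for v
  proof -
    interpret S: pair_graph "\<tau> v" using sub[OF that] unfolding is_tree_def by simp
    interpret T: pair_graph T using T unfolding is_tree_def by simp
    have "subgraph (with_proj (\<tau> v)) (with_proj T)"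
      unfolding subgraph_def
      using S.wf_digraph T.wf_digraph
      by (auto simp: \<tau>_def T_def parent_tree_def compatible_def)
    then show ?thesis unfolding is_subtree_def using sub[OF that] by simp
  qed
  moreover have "pverts (\<tau> u) \<inter> pverts (\<tau> v) \<noteq> {}" if "(u, v) \<in> parcs G" for u v
    using d(5)[of u v] that G.wellformed' unfolding \<tau>_def parent_tree_def by fastforce
  ultimately have "tree_decomposition G T \<tau>"
    unfolding tree_decomposition_def using T by blast
  moreover have "alpha_width G T \<tau> \<le> k"
  proof -
    have "pverts T = {..<n}" by (simp add: T_def parent_tree_def)
    moreover have "bag G \<tau> i = B i" if "i < n" for i
      using d(3)[OF that] that by (auto simp: bag_def \<tau>_def parent_tree_def)
    moreover have "finite (B i)" if "i < n" for i
      using d(3)[OF that] G.pair_finite_verts by (rule finite_subset)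
    ultimately show ?thesis
      unfolding alpha_width_def
      by (subst Max_le_iff) (use d(1) k in \<open>auto intro!: independence_number_le\<close>)
  qed
  ultimately show ?thesis using tree_independence_number_le_iff[OF G] by blast
qed

section \<open>Induced subgraphs\<close>

text \<open>Replaces isomorphic copies by injective maps: the subgraph induced on the image of such
  a map would be isomorphic to \<open>K\<close>.\<close>

lemma induced_free_embedding:
  assumes G: "pair_graph G" and free: "induced_free \<F> G" "K \<in> \<F>" and K: "pair_graph K"
    and f: "inj_on f (pverts K)" "f ` pverts K \<subseteq> pverts G"
  shows "\<not> (\<forall>i\<in>pverts K. \<forall>j\<in>pverts K. (f i, f j) \<in> parcs G \<longleftrightarrow> (i, j) \<in> parcs K)"
proof
  assume adj: "\<forall>i\<in>pverts K. \<forall>j\<in>pverts K. (f i, f j) \<in> parcs G \<longleftrightarrow> (i, j) \<in> parcs K"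
  interpret G: pair_graph G by (rule G)
  interpret K: pair_graph K by (rule K)
  \<comment> \<open>The isomorphism required goes from the induced subgraph to \<open>K\<close>,
    hence the inverse of \<open>f\<close>.\<close>
  define g where "g = the_inv_into (pverts K) f"
  have gf: "g (f i) = i" if "i \<in> pverts K" for i
    unfolding g_def using f(1) that by (rule the_inv_into_f_f)
  define H where "H = with_proj G \<restriction> (f ` pverts K)"
  have H: "induced_subgraph H (with_proj G)"
    unfolding H_def using f(2) by (intro G.induced_induce) auto
  have HV: "verts H = f ` pverts K" by (simp add: H_def)
  have HA: "arcs H = (\<lambda>(i, j). (f i, f j)) ` parcs K"
  proof
    show "arcs H \<subseteq> (\<lambda>(i, j). (f i, f j)) ` parcs K"
      using adj by (auto simp: H_def induce_subgraph_def)
    show "(\<lambda>(i, j). (f i, f j)) ` parcs K \<subseteq> arcs H"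
      using adj K.wellformed' by (auto simp: H_def induce_subgraph_def)
  qed
  define hom where "hom = \<lparr> iso_verts = g, iso_arcs = (\<lambda>(a, b). (g a, g b)), iso_head = snd,
    iso_tail = fst \<rparr>"
  have "wf_digraph H" using H unfolding induced_subgraph_def subgraph_def by blast
  moreover have "tail H = fst" "head H = snd" by (simp_all add: H_def)
  ultimately have "pre_digraph.digraph_isomorphism H hom"
    unfolding pre_digraph.digraph_isomorphism_def hom_def HV HA
    using K.wellformed' by (auto simp: gf inj_on_def)
  moreover have "with_proj K = app_iso hom H"
    unfolding app_iso_def HV HA hom_def with_proj_def
    using K.wellformed' by (force simp: gf image_image case_prod_beta)
  ultimately have "digraph_iso H (with_proj K)" unfolding digraph_iso_def by blast
  then show False using free H unfolding induced_free_def by blast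
qed

section \<open>Translation of the two forbidden induced subgraphs\<close>

lemma P6_free_if_induced_free:
  assumes G: "pair_graph G" and free: "induced_free \<F> G" "path_graph 6 \<in> \<F>"
  shows "P6_free (parcs G) (pverts G)"
  unfolding P6_free_def
proof
  interpret G: pair_graph G by (rule G)
  assume "\<exists>f :: nat \<Rightarrow> 'a. f ` {..<6} \<subseteq> pverts G \<and>
     (\<forall>i j. i < j \<and> j < 6 \<longrightarrow> f i \<noteq> f j \<and> ((f i, f j) \<in> parcs G \<longleftrightarrow> j = Suc i))"
  then obtain f :: "nat \<Rightarrow> 'a" where f: "f ` {..<6} \<subseteq> pverts G"
    "\<And>i j. i < j \<Longrightarrow> j < 6 \<Longrightarrow> f i \<noteq> f j \<and> ((f i, f j) \<in> parcs G \<longleftrightarrow> j = Suc i)" by blast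
  have V: "pverts (path_graph 6) = {..<6}" by (simp add: path_graph_def)
  have "inj_on f {..<6}"
  proof (rule linorder_inj_onI)
    fix i j :: nat assume "i < j" "i \<in> {..<6}" "j \<in> {..<6}"
    then show "f i \<noteq> f j" using f(2)[of i j] by simp
  qed auto
  moreover have "(f i, f j) \<in> parcs G \<longleftrightarrow> (i, j) \<in> parcs (path_graph 6)"
    if "i \<in> {..<6}" "j \<in> {..<6}" for i j
  proof -
    have K: "(i, j) \<in> parcs (path_graph 6) \<longleftrightarrow> j = Suc i \<or> i = Suc j"
      using that by (simp add: path_graph_def)
    consider "i < j" | "i = j" | "j < i" by linarith
    then show ?thesis
    proof cases
      case 1
      then show ?thesis using f(2)[of i j] that unfolding K by simp
    next
      case 2
      then show ?thesis using G.no_loops' unfolding K by auto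
    next
      case 3
      have "(f i, f j) \<in> parcs G \<longleftrightarrow> (f j, f i) \<in> parcs G" by (blast intro: G.arcs_symmetric)
      then show ?thesis using f(2)[of j i] that 3 unfolding K by simp
    qed
  qed
  ultimately show False
    using induced_free_embedding[OF G free pair_graph_path_graph, of f] f(1) unfolding V by blast
qed

lemma pair_graph_complete_bipartite_graph: "pair_graph (complete_bipartite_graph m n)"
  by unfold_locales
    (auto simp: complete_bipartite_graph_def symmetric_def intro!: symI)

text \<open>More than \<open>t - 1\<close> independent common neighbours of two nonadjacent vertices
  contain \<open>t\<close> of them, the large part of an induced biclique.\<close>

lemma biclique_free_if_induced_free:
  assumes G: "pair_graph G"
    and free: "induced_free \<F> G" "complete_bipartite_graph 2 t \<in> \<F>"
  shows "biclique_free (parcs G) (pverts G) (t - 1)"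
  unfolding biclique_free_def
proof (intro ballI impI, rule ccontr)
  interpret G: pair_graph G by (rule G)
  fix u v assume uv: "u \<in> pverts G" "v \<in> pverts G" "u \<noteq> v" "(u, v) \<notin> parcs G"
  assume "\<not> alpha_le (parcs G) (pverts G \<inter> parcs G `` {u} \<inter> parcs G `` {v}) (t - 1)"
  then obtain J where J: "J \<subseteq> pverts G \<inter> parcs G `` {u} \<inter> parcs G `` {v}" "indep (parcs G) J"
    and "\<not> card J \<le> t - 1"
    unfolding alpha_le_def by blast
  then have "t \<le> card J" by simp
  obtain I where I: "I \<subseteq> J" "card I = t" "finite I" using obtain_subset_with_card_n[OF \<open>t \<le> card J\<close>] by metis
  obtain h where h: "bij_betw h {..<t} I"
    using ex_bij_betw_nat_finite[OF I(3)] I(2) by (auto simp: atLeast0LessThan)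
  \<comment> \<open>Vertices 0 and 1 form the part of size two; the others, shifted by 2, enumerate
    \<open>I\<close>.\<close>
  define f where "f i = (if i = 0 then u else if i = 1 then v else h (i - 2))" for i :: nat
  let ?K = "complete_bipartite_graph 2 t"
  have V: "pverts ?K = {..<2 + t}" by (simp add: complete_bipartite_graph_def)
  have hI: "h i \<in> I" if "i < t" for i using h that by (auto simp: bij_betw_def)
  have f2: "f i = h (i - 2)" "f i \<in> I" if "2 \<le> i" "i < 2 + t" for i
    using that hI[of "i - 2"] by (auto simp: f_def)
  have fI: "(u, x) \<in> parcs G" "(v, x) \<in> parcs G" "(x, u) \<in> parcs G" "(x, v) \<in> parcs G"
    "x \<noteq> u" "x \<noteq> v" "x \<in> pverts G" if "x \<in> I" for x
  proof -
    show x: "(u, x) \<in> parcs G" "(v, x) \<in> parcs G" "x \<in> pverts G" using that I(1) J(1) by auto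
    then show "(x, u) \<in> parcs G" "(x, v) \<in> parcs G" by (simp_all add: G.arcs_symmetric)
    show "x \<noteq> u" "x \<noteq> v" using x G.no_loops' by blast+
  qed
  have "inj_on f {..<2 + t}"
  proof (rule linorder_inj_onI)
    fix i j assume ij: "i < j" "i \<in> {..<2 + t}" "j \<in> {..<2 + t}"
    show "f i \<noteq> f j"
    proof (cases "2 \<le> i")
      case True
      have "h (i - 2) \<noteq> h (j - 2)"
        using inj_on_eq_iff[OF bij_betw_imp_inj_on[OF h], of "i - 2" "j - 2"] ij True by auto
      then show ?thesis using True ij f2 by auto
    next
      case False
      then have "i = 0 \<or> i = 1" by auto
      moreover have "j = 1 \<or> 2 \<le> j" using ij by auto
      ultimately show ?thesis
        using uv(3) ij fI(5,6)[OF f2(2)[of j]] by (auto simp: f_def)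
    qed
  qed auto
  moreover have "f ` {..<2 + t} \<subseteq> pverts G"
  proof
    fix x assume "x \<in> f ` {..<2 + t}"
    then obtain i where "i < 2 + t" "x = f i" by auto
    then show "x \<in> pverts G"
      using uv fI(7)[OF f2(2)[of i]] by (cases "2 \<le> i") (auto simp: f_def)
  qed
  moreover have "(f i, f j) \<in> parcs G \<longleftrightarrow> (i, j) \<in> parcs ?K"
    if "i \<in> {..<2 + t}" "j \<in> {..<2 + t}" for i j
  proof -
    have K: "(i, j) \<in> parcs ?K \<longleftrightarrow> (i < 2 \<and> 2 \<le> j \<or> 2 \<le> i \<and> j < 2)"
      using that by (auto simp: complete_bipartite_graph_def)
    have low: "f i \<in> {u, v}" if "i < 2" for i using that by (auto simp: f_def)
    have vu: "(v, u) \<notin> parcs G" "(u, u) \<notin> parcs G" "(v, v) \<notin> parcs G"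
      using uv(4) G.arcs_symmetric G.no_loops' by blast+
    consider "i < 2" "j < 2" | "i < 2" "2 \<le> j" | "2 \<le> i" "j < 2" | "2 \<le> i" "2 \<le> j"
      by linarith
    then show ?thesis
    proof cases
      case 1
      then show ?thesis using low[of i] low[of j] uv(4) vu unfolding K by auto
    next
      case 2
      then show ?thesis using low[of i] fI(1,2)[OF f2(2)[of j]] that unfolding K by auto
    next
      case 3
      then show ?thesis using low[of j] fI(3,4)[OF f2(2)[of i]] that unfolding K by auto
    next
      case 4
      then have "f i \<in> J" "f j \<in> J" using f2(2) that I by auto
      then show ?thesis using 4 J(2) unfolding K indep_def by auto
    qed
  qed
  ultimately show False
    using induced_free_embedding[OF G free pair_graph_complete_bipartite_graph, of f]
    unfolding V by blast
qed

theorem theorem1p3: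
  fixes t :: nat
  assumes "t \<ge> 2"
  shows "\<exists>s :: nat. \<forall>G :: 'a pair_pre_digraph.
    pair_graph G \<longrightarrow> induced_free {path_graph 6, complete_bipartite_graph 2 t} G \<longrightarrow>
    tree_independence_number G \<le> s"
proof (intro exI allI impI)
  fix G :: "'a pair_pre_digraph"
  assume G: "pair_graph G"
    and free: "induced_free {path_graph 6, complete_bipartite_graph 2 t} G"
  interpret G: pair_graph G by (rule G)
  interpret sym_irrefl_rel "parcs G"
    using G.arcs_symmetric G.no_loops' by unfold_locales auto
  have P6: "P6_free (parcs G) (pverts G)"
    using P6_free_if_induced_free[OF G free] by simp
  have bf: "biclique_free (parcs G) (pverts G) (t - 1)"
    using biclique_free_if_induced_free[OF G free] by simp
  \<comment> \<open>The recursion starts with an empty boundary and the separator bound for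
    \<open>m = t - 1\<close>, which is positive as \<open>t \<ge> 2\<close>. Both exclusions pass to
    subsets, so every \<open>V\<close> has balanced separators.\<close>
  have "decomposable (parcs G) (pverts G) {} (5 * Suc (30 * (t - 1) + 1))"
  proof (rule decomposable_if_separators)
    show "finite (pverts G)" by (rule G.pair_finite_verts)
    fix V I assume VI: "V \<subseteq> pverts G" "I \<subseteq> V"
    have "finite I" using VI G.pair_finite_verts by (meson finite_subset)
    moreover have "1 \<le> t - 1" using assms by simp
    ultimately obtain S where "S \<subseteq> V" "alpha_le (parcs G) S (30 * (t - 1) + 1)"
      "\<And>x. x \<in> V - S \<Longrightarrow> 2 * card (I \<inter> component (parcs G) (V - S) x) \<le> card I"
      using balanced_separator[OF _ P6_free_subset[OF P6 VI(1)] biclique_free_subset[OF bf VI(1)]]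
      by metis
    then show "\<exists>S\<subseteq>V. alpha_le (parcs G) S (30 * (t - 1) + 1) \<and>
        (\<forall>x\<in>V - S. 2 * card (I \<inter> component (parcs G) (V - S) x) \<le> card I)"
      by blast
  qed auto
  with G show "tree_independence_number G \<le> 5 * Suc (30 * (t - 1) + 1)"
    by (rule tree_independence_number_le_if_decomposable)
qed

end
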